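(* Let $f:\mathbb{R}^d\to\mathbb{R}$ be twice continuously differentiable with minimizer $x_*$, and suppose there are constants $\mu,L,M>0$ such that: $f$ is strongly convex with parameter $\mu$; $\|\nabla f(x)-\nabla f(y)\|\le L\|x-y\|$ for all $x,y\in\mathbb{R}^d$; and $\|\nabla^2 f(x)-\nabla^2 f(x_* )\|\le M\|x-x_*\|$ for all $x\in\mathbb{R}^d$. Let $\alpha>0$, and let $\{x_k\}_{k\ge0}$ be the iterates generated by the BFGS method with exact line search from an arbitrary initial point $x_0\in\mathbb{R}^d$ and initial matrix $B_0=\alpha I$, and assume $x_k\ne x_*$ for all $k\ge0$. Set $\kappa=L/\mu$ and $C_0=\frac{2M}{\mu^{3/2}}\sqrt{2(f(x_0)-f(x_* ))}$. Then: (i) for every $k\ge1$, $$\frac{f(x_k)-f(x_* )}{f(x_0)-f(x_* )}\le\left(1-e^{-\frac{\frac{\alpha}{L}d-d+d\log\frac{L}{\alpha}}{k}}\,\frac1\kappa\max\left\{\frac{2}{1+\sqrt\kappa},\frac1{1+C_0}\right\}\right)^k;$$ (ii) for every $k\ge1$ with $k\ge d\left(\frac\alpha L-1+\log\frac L\alpha\right)$, $$\frac{f(x_k)-f(x_* )}{f(x_0)-f(x_* )}\le\left(1-\frac1{3\kappa}\max\left\{\frac{2}{1+\sqrt\kappa},\frac1{1+C_0}\right\}\right)^k;$$ (iii) for every $k\ge1$ with $k\ge(1+C_0)d\left(\frac\alpha L-1+\log\frac L\alpha\right)+3C_0\kappa\min\{2(1+C_0),\,1+\sqrt\kappa\}$,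 $$\frac{f(x_k)-f(x_* )}{f(x_0)-f(x_* )}\le\left(1-\frac1{3\kappa}\right)^k.$$
   Context: $\|\cdot\|$ is the Euclidean norm of vectors and the spectral norm of matrices; $\log$ is the natural logarithm. Since $f$ is twice differentiable, strong convexity with parameter $\mu$ and $L$-Lipschitz gradient mean $\mu I\preceq\nabla^2 f(x)\preceq LI$ for all $x$. BFGS method with exact line search: given $x_0\in\mathbb{R}^d$ and symmetric positive definite $B_0$, for $k\ge0$ put $g_k=\nabla f(x_k)$, $d_k=-B_k^{-1}g_k$, $\eta_k=\arg\min_{\eta\ge0}f(x_k+\eta d_k)$, $x_{k+1}=x_k+\eta_kd_k$, $s_k=x_{k+1}-x_k$, $y_k=\nabla f(x_{k+1})-\nabla f(x_k)$, and $$B_{k+1}=B_k-\frac{B_ks_ks_k^\top B_k}{s_k^\top B_ks_k}+\frac{y_ky_k^\top}{s_k^\top y_k}.$$ All $B_k$ are then symmetric positive definite. The standing assumption that $x_k\neq x_*$ for all $k$ ensures that all quantities are well defined. *)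

theory Defs
  imports "HOL-Analysis.Analysis"
begin

definition strongly_convex :: "real \<Rightarrow> ('a::real_inner \<Rightarrow> real) \<Rightarrow> bool" where
  "strongly_convex \<mu> f \<longleftrightarrow>
     (\<forall>x y t. 0 \<le> t \<and> t \<le> 1 \<longrightarrow>
        f ((1 - t) *\<^sub>R x + t *\<^sub>R y)
          \<le> (1 - t) * f x + t * f y - \<mu> / 2 * t * (1 - t) * (norm (x - y))\<^sup>2)"

text \<open>The norm of the type of matrices is the Frobenius norm, so the spectral norm
  is the operator norm of the induced linear map.\<close>

definition spectral_norm :: "real^'n^'m \<Rightarrow> real" where
  "spectral_norm A = onorm (\<lambda>v. A *v v)"

definition outer_prod :: "real^'m \<Rightarrow> real^'n \<Rightarrow> real^'n^'m" where
  "outer_prod u v = (\<chi> i j. u $ i * v $ j)"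

definition bfgs_update :: "real^'n^'n \<Rightarrow> real^'n \<Rightarrow> real^'n \<Rightarrow> real^'n^'n" where
  "bfgs_update B s y =
     B - (B ** outer_prod s s ** B) /\<^sub>R (s \<bullet> (B *v s)) + outer_prod y y /\<^sub>R (s \<bullet> y)"

text \<open>The iterates \<open>x\<close>, matrices \<open>B\<close> and step sizes \<open>\<eta>\<close> form a run of the method for the
  objective \<open>f\<close> with gradient \<open>g\<close>. It is a relation rather than a recursive function because
  the exact step size is a minimizer over the half line, whose existence and uniqueness are
  properties of \<open>f\<close>.\<close>

definition bfgs_exact_line_search ::
    "(real^'n \<Rightarrow> real) \<Rightarrow> (real^'n \<Rightarrow> real^'n) \<Rightarrow>
     (nat \<Rightarrow> real^'n) \<Rightarrow> (nat \<Rightarrow> real^'n^'n) \<Rightarrow> (nat \<Rightarrow> real) \<Rightarrow> bool" where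
  "bfgs_exact_line_search f g x B \<eta> \<longleftrightarrow>
     (\<forall>k. let d = - (matrix_inv (B k) *v g (x k));
              s = x (Suc k) - x k;
              y = g (x (Suc k)) - g (x k)
          in is_arg_min (\<lambda>t. f (x k + t *\<^sub>R d)) (\<lambda>t. 0 \<le> t) (\<eta> k) \<and>
             x (Suc k) = x k + \<eta> k *\<^sub>R d \<and>
             B (Suc k) = bfgs_update (B k) s y)"

end

theory Submission
  imports Defs
begin

text \<open>Write \<open>F\<^sub>i = f x\<^sub>i - f x\<^sub>*\<close>, \<open>g\<^sub>i\<close> for the gradients, \<open>s\<^sub>i\<close> for the steps and \<open>y\<^sub>i\<close> for the
gradient differences. The decrease of one step factors as
\<open>1 - F\<^sub>i\<^sub>+\<^sub>1 / F\<^sub>i = (F\<^sub>i - F\<^sub>i\<^sub>+\<^sub>1) / (- g\<^sub>i \<bullet> s\<^sub>i) * (\<parallel>g\<^sub>i\<parallel>\<^sup>2 / (L F\<^sub>i)) * w\<^sub>i\<close> with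
\<open>w\<^sub>i = L (- g\<^sub>i \<bullet> s\<^sub>i) / \<parallel>g\<^sub>i\<parallel>\<^sup>2\<close>. The first factor measures how much an exact line search
gains compared with the linear prediction, the second is at least \<open>2 / \<kappa>\<close> because a strongly convex
function is dominated by its squared gradient, and the third depends on how well the
quasi-Newton direction is aligned with the gradient.

A single \<open>w\<^sub>i\<close> may be small, but their product is controlled. The potential
\<open>tr (B / L) - d - ln det (B / L)\<close> is nonnegative on symmetric positive definite
matrices (lemma \<open>sym_pos_def_det_pos_and_potential_nonneg\<close>), and a BFGS update with exact line search
increases it by at most \<open>ln w\<^sub>i\<close> (lemma \<open>bfgs_potential_step\<close>): the rank-one terms change trace and
determinant explicitly, the gradient is cocoercive, so that \<open>\<parallel>y\<^sub>i\<parallel>\<^sup>2 \<le> L s\<^sub>i \<bullet> y\<^sub>i\<close>, and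
\<open>ln u \<le> u - 1\<close> absorbs the rest. Hence \<open>\<Sum>i<k. ln w\<^sub>i\<close> is at least minus the initial
potential \<open>P = d (\<alpha> / L - 1 + ln (L / \<alpha>))\<close>.

The first factor is bounded in two ways (lemma \<open>exact_line_search_progress\<close>). Along the step the
second derivative lies between two multiples of \<open>\<parallel>s\<^sub>i\<parallel>\<^sup>2\<close>, and only the ratio of these
multiples matters: it is at most \<open>\<kappa>\<close> globally, and at most \<open>1 + C\<^sub>i\<close> with
\<open>C\<^sub>i = C\<^sub>0 sqrt (F\<^sub>i / F\<^sub>0)\<close> because the Hessian on the step is close to the Hessian at the
minimizer.

The inequality between arithmetic and geometric means turns a lower bound for the product of the
relative decreases into a contraction rate (lemma \<open>contraction_le_geometric_mean_power\<close>). With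
\<open>C\<^sub>i \<le> C\<^sub>0\<close> it gives the first claim, and the second since \<open>exp (- P / k) \<ge> 1 / 3\<close> once
\<open>k \<ge> P\<close>. The second claim makes \<open>C\<^sub>i\<close> decay geometrically after \<open>P\<close> steps, so
\<open>\<Sum>i. C\<^sub>i\<close> is bounded independently of \<open>k\<close>; for \<open>k\<close> at least \<open>P\<close> plus this bound, the
total loss caused by \<open>P\<close> and the \<open>C\<^sub>i\<close> is again at most a factor \<open>1 / 3\<close> per step, which is the third claim
(lemma \<open>rates_from_potential_bound\<close>).\<close>

section \<open>Rank-one matrices\<close>

lemma outer_prod_vector_mult: "outer_prod u v *v w = (v \<bullet> w) *\<^sub>R u"
  by (simp add: vec_eq_iff outer_prod_def matrix_vector_mult_def inner_vec_def
      sum_distrib_left sum_distrib_right mult_ac)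

lemma trace_outer_prod: "trace (outer_prod u v) = u \<bullet> v"
  by (simp add: trace_def outer_prod_def inner_vec_def)

lemma trace_scaleR: "trace (c *\<^sub>R A) = c * trace (A :: real^'n^'n)"
  by (simp add: trace_def sum_distrib_left)

lemma matrix_mult_outer_prod: "A ** outer_prod u v = outer_prod (A *v u) v"
  by (simp add: matrix_eq outer_prod_vector_mult matrix_vector_mult_scaleR
      flip: matrix_vector_mul_assoc)

lemma outer_prod_matrix_mult: "outer_prod u v ** A = outer_prod u (transpose A *v v)"
  by (simp add: matrix_eq outer_prod_vector_mult dot_lmul_matrix flip: matrix_vector_mul_assoc)

lemma det_scaleR_mat_1: "det (c *\<^sub>R mat 1 :: real^'n^'n) = c ^ CARD('n)"
  by (subst det_diagonal) (auto simp: mat_def)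

text \<open>If \<open>v $ k \<noteq> 0\<close>, the matrix \<open>P\<close> obtained from the identity by putting \<open>v\<close> in row \<open>k\<close> satisfies
\<open>transpose P *v axis k 1 = v\<close>. Conjugation with \<open>P\<close> therefore turns the perturbation into one that
touches only column \<open>k\<close>, and Cramer's rule evaluates both determinants that occur.\<close>

lemma det_rank_one_update: "det (mat 1 + outer_prod u v :: real^'n^'n) = 1 + u \<bullet> v"
proof (cases "v = 0")
  case True
  then have "outer_prod u v = 0" by (simp add: vec_eq_iff outer_prod_def)
  then show ?thesis using True by simp
next
  case False
  then obtain k where k: "v $ k \<noteq> 0" by (auto simp: vec_eq_iff)
  define P :: "real^'n^'n" where "P = (\<chi> i. if i = k then v else axis i 1)"
  have "det P = v $ k"
  proof -
    have "P = (\<chi> i. if i = k then sum (\<lambda>i. v$i *s row i (mat 1)) UNIV else row i (mat 1))"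
      unfolding P_def by (rule Cart_lambda_cong)
        (auto simp: vec_eq_iff row_def mat_def axis_def sum.delta if_distrib cong: if_cong)
    then show ?thesis using cramer_lemma_transpose[of k v "mat 1"] by simp
  qed
  have v_eq: "transpose P *v axis k 1 = v"
    by (simp add: vec_eq_iff transpose_def P_def matrix_vector_mult_basis column_def)
  have "P ** (mat 1 + outer_prod u v) = (mat 1 + outer_prod (P *v u) (axis k 1)) ** P"
    by (simp add: matrix_eq matrix_vector_mult_add_rdistrib matrix_vector_right_distrib
        outer_prod_vector_mult matrix_vector_mult_scaleR v_eq
        flip: matrix_vector_mul_assoc dot_lmul_matrix transpose_matrix_vector)
  then have "det P * det (mat 1 + outer_prod u v)
    = det (mat 1 + outer_prod (P *v u) (axis k 1 :: real^'n)) * det P"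
    by (metis det_mul)
  moreover have "det (mat 1 + outer_prod (P *v u) (axis k 1 :: real^'n)) = 1 + u \<bullet> v"
  proof -
    let ?w = "axis k 1 + P *v u"
    have "mat 1 + outer_prod (P *v u) (axis k 1)
      = (\<chi> i j. if j = k then (mat 1 *v ?w) $ i else mat 1 $ i $ j)"
      unfolding matrix_vector_mul_lid
      by (auto simp: vec_eq_iff outer_prod_def axis_def mat_def)
    then have "det (mat 1 + outer_prod (P *v u) (axis k 1)) = ?w $ k"
      using cramer_lemma[where A = "mat 1" and k = k and x = ?w] by simp
    also have "\<dots> = 1 + u \<bullet> v"
      by (simp add: axis_def matrix_vector_mul_component P_def inner_commute)
    finally show ?thesis .
  qed
  ultimately show ?thesis using \<open>det P = v $ k\<close> k by simp
qed

section \<open>Symmetric positive definite matrices\<close>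

definition sym_pos_def :: "real^'n^'n \<Rightarrow> bool" where
  "sym_pos_def A \<longleftrightarrow> transpose A = A \<and> (\<forall>v. v \<noteq> 0 \<longrightarrow> 0 < v \<bullet> (A *v v))"

lemma sym_pos_def_pos: "sym_pos_def A \<Longrightarrow> v \<noteq> 0 \<Longrightarrow> 0 < v \<bullet> (A *v v)"
  by (simp add: sym_pos_def_def)

lemma sym_pos_def_inner_commute: "sym_pos_def A \<Longrightarrow> v \<bullet> (A *v w) = (A *v v) \<bullet> w"
  by (metis dot_lmul_matrix sym_pos_def_def transpose_matrix_vector)

lemma sym_pos_def_scaleR_mat_1: "c > 0 \<Longrightarrow> sym_pos_def (c *\<^sub>R mat 1)"
  by (simp add: sym_pos_def_def transpose_scalar transpose_mat flip: scaleR_matrix_vector_assoc)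

lemma sym_pos_def_invertible:
  fixes A :: "real^'n^'n"
  assumes "sym_pos_def A"
  shows "invertible A"
proof -
  have "v = 0" if "A *v v = 0" for v
    using sym_pos_def_pos[OF assms, of v] that by auto
  then show ?thesis by (simp add: invertible_left_inverse matrix_left_invertible_ker)
qed

lemma sym_pos_def_congruence:
  fixes A E :: "real^'n^'n"
  assumes "sym_pos_def A" "invertible E"
  shows "sym_pos_def (E ** A ** transpose E)"
  unfolding sym_pos_def_def
proof (intro conjI allI impI)
  show "transpose (E ** A ** transpose E) = E ** A ** transpose E"
    using assms(1) by (simp add: matrix_transpose_mul matrix_mul_assoc sym_pos_def_def)
next
  fix v :: "real^'n" assume "v \<noteq> 0"
  then have "transpose E *v v \<noteq> 0"
    using transpose_invertible[OF assms(2)] 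
    by (metis invertible_def matrix_left_invertible_ker)
  then have "0 < (transpose E *v v) \<bullet> (A *v (transpose E *v v))"
    by (rule sym_pos_def_pos[OF assms(1)])
  also have "\<dots> = v \<bullet> ((E ** A ** transpose E) *v v)"
    by (simp add: dot_lmul_matrix flip: matrix_vector_mul_assoc)
  finally show "0 < v \<bullet> ((E ** A ** transpose E) *v v)" .
qed

section \<open>The BFGS update as a congruence\<close>

lemma bfgs_update_vector_mult:
  assumes "sym_pos_def A"
  shows "bfgs_update A s y *v w
    = A *v w - ((A *v s) \<bullet> w / (s \<bullet> (A *v s))) *\<^sub>R (A *v s) + (y \<bullet> w / (s \<bullet> y)) *\<^sub>R y"
  unfolding bfgs_update_def
  by (simp add: matrix_vector_mult_add_rdistrib matrix_vector_mult_diff_rdistrib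
      outer_prod_vector_mult matrix_mult_outer_prod matrix_vector_mult_scaleR
      sym_pos_def_inner_commute[OF assms] divide_inverse mult_ac
      flip: scaleR_matrix_vector_assoc matrix_vector_mul_assoc)

text \<open>The product form of the BFGS update. Positive definiteness and the determinant of the updated
matrix can both be read off from it, since \<open>E\<close> is a rank-one perturbation of the identity.\<close>

lemma bfgs_update_congruence:
  assumes A: "sym_pos_def A" and sy: "s \<bullet> y > 0"
  defines "\<beta> \<equiv> sqrt (s \<bullet> y / (s \<bullet> (A *v s)))"
  defines "E \<equiv> mat 1 + outer_prod ((\<beta> / (s \<bullet> y)) *\<^sub>R (y - \<beta> *\<^sub>R (A *v s))) s"
  shows "bfgs_update A s y = E ** A ** transpose E" and "det E = \<beta>"
proof -
  let ?p = "A *v s" and ?\<sigma> = "s \<bullet> (A *v s)" and ?\<tau> = "s \<bullet> y"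
  define u where "u = (\<beta> / ?\<tau>) *\<^sub>R (y - \<beta> *\<^sub>R ?p)"
  have s0: "s \<noteq> 0" using sy by auto
  then have \<sigma>: "?\<sigma> > 0" using sym_pos_def_pos[OF A] by blast
  then have \<beta>: "\<beta> > 0" "\<beta> * \<beta> = ?\<tau> / ?\<sigma>" using sy by (auto simp: \<beta>_def)
  have E_mult: "E *v w = w + (s \<bullet> w) *\<^sub>R u" for w
    by (simp add: E_def u_def matrix_vector_mult_add_rdistrib outer_prod_vector_mult)
  have ET_mult: "transpose E *v w = w + (u \<bullet> w) *\<^sub>R s" for w
  proof -
    have "transpose E = mat 1 + outer_prod s u"
      by (simp add: E_def u_def vec_eq_iff transpose_def mat_def outer_prod_def)
    then show ?thesis by (simp add: matrix_vector_mult_add_rdistrib outer_prod_vector_mult)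
  qed
  have "(E ** A ** transpose E) *v w = bfgs_update A s y *v w" for w
  proof -
    have uw: "u \<bullet> w = (\<beta> / ?\<tau>) * (y \<bullet> w - \<beta> * (?p \<bullet> w))"
      by (simp add: u_def inner_diff_left)
    \<comment> \<open>The choice of \<open>\<beta>\<close> makes the mixed terms in \<open>A *v s\<close> and \<open>w\<close> cancel here.\<close>
    have coeff: "?p \<bullet> w + (u \<bullet> w) * ?\<sigma> = (y \<bullet> w) / \<beta>"
    proof -
      have "\<beta> * (?p \<bullet> w + (u \<bullet> w) * ?\<sigma>) 
        = \<beta> * (?p \<bullet> w) + (\<beta> * \<beta>) * ?\<sigma> / ?\<tau> * (y \<bullet> w - \<beta> * (?p \<bullet> w))"
        unfolding uw by (simp only: ring_distribs mult_ac diff_divide_distrib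
            times_divide_eq_left times_divide_eq_right)
      also have "\<dots> = y \<bullet> w" using \<sigma> sy \<beta>(2) by simp
      finally show ?thesis using \<beta>(1) by (simp add: field_simps)
    qed
    have "(E ** A ** transpose E) *v w
      = A *v w + (u \<bullet> w) *\<^sub>R ?p + (?p \<bullet> w + (u \<bullet> w) * ?\<sigma>) *\<^sub>R u"
      by (simp add: E_mult ET_mult matrix_vector_right_distrib matrix_vector_mult_scaleR
          inner_add_right sym_pos_def_inner_commute[OF A] scaleR_add_left scaleR_add_right
          flip: matrix_vector_mul_assoc del: transpose_matrix_vector)
    also have "\<dots> = A *v w + ((\<beta> / ?\<tau>) * (y \<bullet> w) - (\<beta> * \<beta> / ?\<tau>) * (?p \<bullet> w)) *\<^sub>R ?p
        + ((y \<bullet> w) / ?\<tau>) *\<^sub>R y - ((\<beta> / ?\<tau>) * (y \<bullet> w)) *\<^sub>R ?p"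
    proof -
      have "(u \<bullet> w) *\<^sub>R ?p = ((\<beta> / ?\<tau>) * (y \<bullet> w) - (\<beta> * \<beta> / ?\<tau>) * (?p \<bullet> w)) *\<^sub>R ?p"
        by (simp add: uw algebra_simps)
      moreover have "((y \<bullet> w) / \<beta>) *\<^sub>R u = ((y \<bullet> w) / ?\<tau>) *\<^sub>R y - ((\<beta> / ?\<tau>) * (y \<bullet> w)) *\<^sub>R ?p"
        using \<beta>(1) by (simp add: u_def algebra_simps)
      ultimately show ?thesis unfolding coeff by (simp only: add.assoc add_diff_eq)
    qed
    also have "\<dots> = bfgs_update A s y *v w"
      unfolding bfgs_update_vector_mult[OF A] \<beta>(2) using sy by (simp add: algebra_simps)
    finally show ?thesis .
  qed
  then show "bfgs_update A s y = E ** A ** transpose E" by (simp add: matrix_eq)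
  have "u \<bullet> s = (\<beta> / ?\<tau>) * ?\<tau> - (\<beta> * \<beta>) * ?\<sigma> / ?\<tau>"
    by (simp add: u_def inner_diff_left inner_commute algebra_simps diff_divide_distrib)
  then have "u \<bullet> s = \<beta> - 1" using \<beta>(2) \<sigma> sy by simp
  then show "det E = \<beta>" by (simp add: E_def det_rank_one_update flip: u_def)
qed

lemma sym_pos_def_bfgs_update:
  assumes "sym_pos_def A" "s \<bullet> y > 0"
  shows "sym_pos_def (bfgs_update A s y)"
proof -
  have "s \<bullet> (A *v s) > 0" using assms by (intro sym_pos_def_pos) auto
  then show ?thesis
    using bfgs_update_congruence[OF assms] assms
    by (simp add: sym_pos_def_congruence invertible_det_nz)
qed

lemma det_bfgs_update:
  assumes "sym_pos_def A" "s \<bullet> y > 0"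
  shows "det (bfgs_update A s y) = s \<bullet> y / (s \<bullet> (A *v s)) * det A"
proof -
  have "s \<bullet> (A *v s) > 0" using assms by (intro sym_pos_def_pos) auto
  then show ?thesis
    using bfgs_update_congruence[OF assms] real_sqrt_mult_self[of "s \<bullet> y / (s \<bullet> (A *v s))"] assms(2)
    by (simp only: det_mul det_transpose) (simp add: mult.commute mult.left_commute)
qed

lemma trace_bfgs_update:
  assumes "sym_pos_def A"
  shows "trace (bfgs_update A s y)
    = trace A - (norm (A *v s))\<^sup>2 / (s \<bullet> (A *v s)) + (norm y)\<^sup>2 / (s \<bullet> y)"
  using assms
  by (simp add: bfgs_update_def trace_add trace_sub trace_scaleR matrix_mult_outer_prod
      outer_prod_matrix_mult trace_outer_prod sym_pos_def_def power2_norm_eq_inner divide_inverse mult_ac)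

section \<open>The trace-determinant potential\<close>

text \<open>This is \<open>trace (A / c) - n - ln (det (A / c))\<close>, that is \<open>\<Sum>\<lambda>. \<lambda> / c - 1 - ln (\<lambda> / c)\<close> over the
eigenvalues of \<open>A\<close>, a measure of the distance of \<open>A\<close> from \<open>c\<close> times the identity.\<close>

definition bfgs_potential :: "real \<Rightarrow> real^'n^'n \<Rightarrow> real" where
  "bfgs_potential c A = trace A / c - CARD('n) - ln (det A) + CARD('n) * ln c"

lemma bfgs_potential_scaleR_mat_1:
  assumes "a > 0" "c > 0"
  shows "bfgs_potential c (a *\<^sub>R mat 1 :: real^'n^'n)
    = a / c * CARD('n) - CARD('n) + CARD('n) * ln (c / a)"
  using assms
  by (simp add: bfgs_potential_def trace_scaleR trace_I det_scaleR_mat_1 ln_realpow ln_div algebra_simps)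

lemma bfgs_potential_update:
  assumes "sym_pos_def A" "s \<bullet> y > 0" "det A > 0"
  shows "bfgs_potential c (bfgs_update A s y) = bfgs_potential c A
    + ((norm y)\<^sup>2 / (s \<bullet> y) - (norm (A *v s))\<^sup>2 / (s \<bullet> (A *v s))) / c
    - ln (s \<bullet> y / (s \<bullet> (A *v s)))"
proof -
  have "s \<bullet> (A *v s) > 0" using assms by (intro sym_pos_def_pos) auto
  then have "ln (det (bfgs_update A s y)) = ln (s \<bullet> y / (s \<bullet> (A *v s))) + ln (det A)"
    unfolding det_bfgs_update[OF assms(1,2)] using assms by (intro ln_mult_pos divide_pos_pos)
  then show ?thesis
    using assms by (simp add: bfgs_potential_def trace_bfgs_update add_divide_distrib diff_divide_distrib)
qed

text \<open>The BFGS update itself gives a proof without eigenvalues. Updating \<open>A\<close> with a unit vector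
\<open>s = axis i 1\<close> and \<open>y = c s\<close> does not increase the potential, makes \<open>s\<close> an eigenvector with
eigenvalue \<open>c\<close>, and keeps every unit vector orthogonal to \<open>s\<close> that already is such an eigenvector.
After finitely many updates \<open>A\<close> has become \<open>c\<close> times the identity, whose potential is zero. The
updates also multiply the determinant by positive factors, so its sign is that of \<open>c ^ n\<close>.\<close>

lemma sym_pos_def_det_pos_and_potential_nonneg:
  fixes A :: "real^'n^'n"
  assumes "sym_pos_def A" "c > 0"
  shows "det A > 0 \<and> bfgs_potential c A \<ge> 0"
  using assms(1)
proof (induction "card {i. A *v axis i 1 \<noteq> c *\<^sub>R axis i 1}" arbitrary: A rule: less_induct)
  case less
  note A = \<open>sym_pos_def A\<close>
  show ?case
  proof (cases "\<forall>i. A *v axis i 1 = c *\<^sub>R axis i 1")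
    case True
    then have "A = c *\<^sub>R mat 1"
      unfolding matrix_vector_mult_basis
      by (auto simp: vec_eq_iff column_def axis_def mat_def)
    then show ?thesis
      using \<open>c > 0\<close> by (simp add: det_scaleR_mat_1 bfgs_potential_scaleR_mat_1)
  next
    case False
    then obtain i where i: "A *v axis i 1 \<noteq> c *\<^sub>R axis i 1" by blast
    let ?s = "axis i 1 :: real^'n"
    let ?A = "bfgs_update A ?s (c *\<^sub>R ?s)"
    let ?\<sigma> = "?s \<bullet> (A *v ?s)"
    have ss: "?s \<bullet> ?s = 1" by (simp add: inner_axis_axis)
    have sy: "?s \<bullet> (c *\<^sub>R ?s) > 0" using \<open>c > 0\<close> ss by simp
    have \<sigma>: "?\<sigma> > 0" using A by (intro sym_pos_def_pos) (auto simp: axis_eq_0_iff)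
    have secant: "?A *v ?s = c *\<^sub>R ?s"
      using \<sigma> \<open>c > 0\<close> ss by (simp add: bfgs_update_vector_mult[OF A] inner_commute)
    have kept: "?A *v axis j 1 = c *\<^sub>R axis j 1" if "A *v axis j 1 = c *\<^sub>R axis j 1" for j
    proof -
      have "j \<noteq> i" using that i by auto
      then have "?s \<bullet> axis j 1 = 0" by (simp add: inner_axis_axis)
      then show ?thesis
        by (simp add: bfgs_update_vector_mult[OF A] that flip: sym_pos_def_inner_commute[OF A])
    qed
    have "{j. ?A *v axis j 1 \<noteq> c *\<^sub>R axis j 1} \<subset> {j. A *v axis j 1 \<noteq> c *\<^sub>R axis j 1}"
      using i secant kept by blast
    then have IH: "det ?A > 0" "bfgs_potential c ?A \<ge> 0"
      using less(1)[OF psubset_card_mono sym_pos_def_bfgs_update[OF A sy]] by auto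
    have det_A: "det A > 0"
      using IH(1) \<sigma> sy by (simp add: det_bfgs_update[OF A sy] zero_less_mult_iff zero_less_divide_iff)
    \<comment> \<open>By Cauchy-Schwarz the trace drops by at least \<open>\<sigma> - c\<close>, which \<open>ln u \<le> u - 1\<close> at
      \<open>u = \<sigma> / c\<close> weighs against the change of the determinant.\<close>
    have "?\<sigma> \<le> norm (A *v ?s)" using norm_cauchy_schwarz[of ?s "A *v ?s"] by (simp add: norm_axis_1)
    then have "?\<sigma>\<^sup>2 \<le> (norm (A *v ?s))\<^sup>2" using \<sigma> by (intro power_mono) auto
    then have cs: "?\<sigma> \<le> (norm (A *v ?s))\<^sup>2 / ?\<sigma>"
      using \<sigma> by (simp add: power2_eq_square field_simps)
    have "bfgs_potential c ?A = bfgs_potential c A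
        + (c - (norm (A *v ?s))\<^sup>2 / ?\<sigma>) / c + ln (?\<sigma> / c)"
      using \<sigma> \<open>c > 0\<close> ss
      by (simp add: bfgs_potential_update[OF A sy det_A] power2_eq_square ln_div norm_axis_1)
    also have "\<dots> \<le> bfgs_potential c A + (c - ?\<sigma>) / c + ln (?\<sigma> / c)"
      using cs \<open>c > 0\<close> by (simp add: divide_right_mono)
    also have "\<dots> \<le> bfgs_potential c A"
      using ln_le_minus_one[of "?\<sigma> / c"] \<sigma> \<open>c > 0\<close> by (simp add: diff_divide_distrib)
    finally show ?thesis using IH det_A by simp
  qed
qed

section \<open>Gradient inequalities for strongly convex and smooth functions\<close>

lemma GDERIV_imp_DERIV_along_line:
  assumes "GDERIV f (z + t *\<^sub>R h) :> g"
  shows "((\<lambda>t. f (z + t *\<^sub>R h)) has_real_derivative g \<bullet> h) (at t)"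
proof -
  have "((\<lambda>t. z + t *\<^sub>R h) has_derivative (\<lambda>t. t *\<^sub>R h)) (at t)"
    by (auto intro!: derivative_eq_intros)
  from has_derivative_compose[OF this, of f "\<lambda>v. v \<bullet> g"] assms
  have "((\<lambda>t. f (z + t *\<^sub>R h)) has_derivative (\<lambda>t. (t *\<^sub>R h) \<bullet> g)) (at t)"
    by (auto simp: gderiv_def)
  then show ?thesis
    by (simp add: has_field_derivative_def inner_commute mult_commute_abs)
qed

lemma increment_le_of_derivative_le:
  fixes \<phi> \<psi> :: "real \<Rightarrow> real"
  assumes "a \<le> b"
    and "\<And>t. a \<le> t \<Longrightarrow> t \<le> b \<Longrightarrow> (\<phi> has_real_derivative \<phi>' t) (at t)"
    and "\<And>t. a \<le> t \<Longrightarrow> t \<le> b \<Longrightarrow> (\<psi> has_real_derivative \<psi>' t) (at t)"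
    and "\<And>t. a \<le> t \<Longrightarrow> t \<le> b \<Longrightarrow> \<phi>' t \<le> \<psi>' t"
  shows "\<phi> b - \<phi> a \<le> \<psi> b - \<psi> a"
proof -
  have "\<psi> a - \<phi> a \<le> \<psi> b - \<phi> b"
    using assms by (intro DERIV_nonneg_imp_nondecreasing[of a b "\<lambda>t. \<psi> t - \<phi> t"])
      (auto intro!: exI[of _ "\<psi>' _ - \<phi>' _"] DERIV_diff)
  then show ?thesis by simp
qed

text \<open>The defining inequality bounds the difference quotients of \<open>f\<close> at \<open>x\<close> in direction \<open>y - x\<close>; letting
the step tend to zero from the right turns them into the directional derivative.\<close>

lemma strongly_convex_gradient_lower_bound:
  assumes "strongly_convex \<mu> f" "GDERIV f x :> g"
  shows "f x + g \<bullet> (y - x) + \<mu> / 2 * (norm (y - x))\<^sup>2 \<le> f y"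
proof -
  let ?q = "\<lambda>t. (f (x + t *\<^sub>R (y - x)) - f x) / t"
  let ?N = "(norm (y - x))\<^sup>2"
  have "((\<lambda>t. f (x + t *\<^sub>R (y - x))) has_real_derivative g \<bullet> (y - x)) (at 0)"
    using assms(2) by (intro GDERIV_imp_DERIV_along_line) simp
  then have lim: "(?q \<longlongrightarrow> g \<bullet> (y - x)) (at_right 0)"
    by (intro tendsto_mono[OF at_le[of "{0<..}" UNIV 0]]) (auto simp: DERIV_def)
  have bound: "eventually (\<lambda>t. ?q t \<le> f y - f x - \<mu> / 2 * (1 - t) * ?N) (at_right 0)"
  proof (rule eventually_at_rightI[of 0 1])
    fix t :: real assume t: "t \<in> {0<..<1}"
    have "(1 - t) *\<^sub>R x + t *\<^sub>R y = x + t *\<^sub>R (y - x)" by (simp add: algebra_simps)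
    then have "f (x + t *\<^sub>R (y - x)) \<le> (1 - t) * f x + t * f y - \<mu> / 2 * t * (1 - t) * ?N"
      using assms(1) t by (metis strongly_convex_def greaterThanLessThan_iff less_imp_le norm_minus_commute)
    then have "f (x + t *\<^sub>R (y - x)) - f x \<le> (f y - f x - \<mu> / 2 * (1 - t) * ?N) * t"
      by (simp add: algebra_simps)
    then show "?q t \<le> f y - f x - \<mu> / 2 * (1 - t) * ?N"
      using t by (simp add: divide_le_eq)
  qed simp
  have "((\<lambda>t::real. f y - f x - \<mu> / 2 * (1 - t) * ?N) \<longlongrightarrow> f y - f x - \<mu> / 2 * (1 - 0) * ?N) (at_right 0)"
    by (intro tendsto_intros)
  from tendsto_le[OF _ this lim bound] show ?thesis by simp
qed

lemma strongly_convex_gradient_monotone: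
  assumes "strongly_convex \<mu> f" "GDERIV f x :> g" "GDERIV f y :> h"
  shows "\<mu> * (norm (y - x))\<^sup>2 \<le> (h - g) \<bullet> (y - x)"
  using strongly_convex_gradient_lower_bound[OF assms(1,2), of y]
    strongly_convex_gradient_lower_bound[OF assms(1,3), of x]
  by (simp add: norm_minus_commute inner_diff_left inner_diff_right)

text \<open>The quadratic lower bound, minimized over all displacements, lies \<open>(norm g)\<^sup>2 / (2 * \<mu>)\<close> below
\<open>f x\<close>. The nonnegative square in the proof is the one completed in this minimization.\<close>

lemma strongly_convex_gradient_dominance:
  assumes "strongly_convex \<mu> f" "GDERIV f x :> g" "\<mu> > 0"
  shows "2 * \<mu> * (f x - f y) \<le> (norm g)\<^sup>2"
proof -
  have "0 \<le> (norm (g + \<mu> *\<^sub>R (y - x)))\<^sup>2" by simp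
  also have "\<dots> = (norm g)\<^sup>2 + 2 * \<mu> * (g \<bullet> (y - x) + \<mu> / 2 * (norm (y - x))\<^sup>2)"
    unfolding power2_norm_eq_inner
    by (simp add: inner_add_left inner_add_right inner_commute algebra_simps)
  also have "\<dots> \<le> (norm g)\<^sup>2 + 2 * \<mu> * (f y - f x)"
    using strongly_convex_gradient_lower_bound[OF assms(1,2), of y] \<open>\<mu> > 0\<close>
    by (intro add_left_mono mult_left_mono) auto
  finally show ?thesis by (simp add: algebra_simps)
qed

lemma GDERIV_at_minimizer:
  assumes "GDERIV f x :> g" "\<And>z. f x \<le> f z"
  shows "g = 0"
proof -
  have "((\<lambda>t. f (x + t *\<^sub>R g)) has_real_derivative g \<bullet> g) (at 0)"
    using assms(1) by (intro GDERIV_imp_DERIV_along_line) simp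
  then have "g \<bullet> g = 0" by (rule DERIV_local_min[of _ _ _ 1]) (use assms(2) in auto)
  then show ?thesis by simp
qed

lemma lipschitz_gradient_upper_bound:
  assumes "\<And>z. GDERIV f z :> grad z"
    and "\<And>z w. norm (grad z - grad w) \<le> L * norm (z - w)"
  shows "f y \<le> f x + grad x \<bullet> (y - x) + L / 2 * (norm (y - x))\<^sup>2"
proof -
  let ?h = "y - x"
  have "f (x + 1 *\<^sub>R ?h) - f (x + 0 *\<^sub>R ?h)
    \<le> (1 * (grad x \<bullet> ?h) + L / 2 * 1\<^sup>2 * (norm ?h)\<^sup>2) - (0 * (grad x \<bullet> ?h) + L / 2 * 0\<^sup>2 * (norm ?h)\<^sup>2)"
  proof (rule increment_le_of_derivative_le)
    fix t :: real assume t: "0 \<le> t"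
    show "((\<lambda>t. f (x + t *\<^sub>R ?h)) has_real_derivative grad (x + t *\<^sub>R ?h) \<bullet> ?h) (at t)"
      using assms(1) by (rule GDERIV_imp_DERIV_along_line)
    show "((\<lambda>t. t * (grad x \<bullet> ?h) + L / 2 * t\<^sup>2 * (norm ?h)\<^sup>2) has_real_derivative
        grad x \<bullet> ?h + L * t * (norm ?h)\<^sup>2) (at t)"
      by (auto intro!: derivative_eq_intros)
    have "(grad (x + t *\<^sub>R ?h) - grad x) \<bullet> ?h \<le> norm (grad (x + t *\<^sub>R ?h) - grad x) * norm ?h"
      by (rule norm_cauchy_schwarz)
    also have "\<dots> \<le> (L * norm (t *\<^sub>R ?h)) * norm ?h"
      using assms(2)[of "x + t *\<^sub>R ?h" x] by (intro mult_right_mono) auto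
    finally show "grad (x + t *\<^sub>R ?h) \<bullet> ?h \<le> grad x \<bullet> ?h + L * t * (norm ?h)\<^sup>2"
      using t by (simp add: inner_diff_left power2_eq_square mult_ac)
  qed simp
  then show ?thesis by simp
qed

text \<open>Subtracting the tangent at \<open>a\<close> leaves a convex function with minimum at \<open>a\<close> whose gradient at \<open>b\<close> is
\<open>grad b - grad a\<close>. One gradient step of length \<open>1 / L\<close> from \<open>b\<close> decreases it by at least
\<open>(norm (grad b - grad a))\<^sup>2 / (2 * L)\<close> and cannot pass below the minimum. Adding this for both orders
of the two points gives the claim.\<close>

lemma gradient_cocoercive:
  assumes convex: "\<And>x y. f x + grad x \<bullet> (y - x) \<le> f y"
    and smooth: "\<And>x y. f y \<le> f x + grad x \<bullet> (y - x) + L / 2 * (norm (y - x))\<^sup>2"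
    and "L > 0"
  shows "(norm (grad y - grad x))\<^sup>2 \<le> L * ((y - x) \<bullet> (grad y - grad x))"
proof -
  have one_sided: "f a + grad a \<bullet> (b - a) + (norm (grad b - grad a))\<^sup>2 / (2 * L) \<le> f b" for a b
  proof -
    let ?D = "grad b - grad a"
    define w where "w = b - (1 / L) *\<^sub>R ?D"
    have wb: "w - b = - ((1 / L) *\<^sub>R ?D)" by (simp add: w_def)
    have "f a + grad a \<bullet> (b - a) + grad a \<bullet> (w - b) \<le> f w"
      using convex[of a w] by (simp add: inner_diff_right)
    also have "f w \<le> f b + grad b \<bullet> (w - b) + L / 2 * (norm (w - b))\<^sup>2"
      by (rule smooth)
    finally have "f a + grad a \<bullet> (b - a) \<le> f b + ?D \<bullet> (w - b) + L / 2 * (norm (w - b))\<^sup>2"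
      by (simp add: inner_diff_left)
    also have "\<dots> = f b - (norm ?D)\<^sup>2 / (2 * L)"
      unfolding wb using \<open>L > 0\<close>
      by (simp add: power_mult_distrib power2_norm_eq_inner[symmetric] power_divide)
         (simp add: field_simps power2_eq_square)
    finally show ?thesis by simp
  qed
  have "2 * ((norm (grad y - grad x))\<^sup>2 / (2 * L)) \<le> (y - x) \<bullet> (grad y - grad x)"
    using one_sided[of x y] one_sided[of y x]
    by (simp add: norm_minus_commute inner_diff_left inner_diff_right inner_commute)
  then show ?thesis using \<open>L > 0\<close> by (simp add: field_simps)
qed

section \<open>Decrease under exact line search\<close>

text \<open>The curvature of \<open>\<phi>\<close> on the unit interval lies between \<open>m\<close> and \<open>l\<close>, in the weak form that is needed
at the two end points. Up to the point \<open>\<tau>\<close> use the upper curvature bound at \<open>0\<close>, from there on the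
lower curvature bound at the stationary point \<open>1\<close>.\<close>

lemma exact_line_search_decrease:
  fixes \<phi> :: "real \<Rightarrow> real"
  assumes deriv: "\<And>t. 0 \<le> t \<Longrightarrow> t \<le> 1 \<Longrightarrow> (\<phi> has_real_derivative \<phi>' t) (at t)"
    and stationary: "\<phi>' 1 = 0" and "m > 0"
    and upper: "\<And>t. 0 \<le> t \<Longrightarrow> t \<le> 1 \<Longrightarrow> \<phi>' t - \<phi>' 0 \<le> l * t"
    and lower: "\<And>t. 0 \<le> t \<Longrightarrow> t \<le> 1 \<Longrightarrow> m * (1 - t) \<le> \<phi>' 1 - \<phi>' t"
  shows "- \<phi>' 0 / (1 + sqrt (l / m)) \<le> \<phi> 0 - \<phi> 1"
proof -
  \<comment> \<open>This \<open>\<tau>\<close> makes the two quadratic error terms cancel.\<close>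
  define \<tau> where "\<tau> = 1 / (1 + sqrt (l / m))"
  have "l > 0" using upper[of 1] lower[of 0] \<open>m > 0\<close> by simp
  then have root: "sqrt (l / m) \<ge> 0" using \<open>m > 0\<close> by simp
  then have \<tau>: "0 < \<tau>" "\<tau> \<le> 1" by (auto simp: \<tau>_def divide_le_eq add_pos_nonneg)
  have "1 - \<tau> = \<tau> * sqrt (l / m)" using root by (simp add: \<tau>_def field_simps add_nonneg_eq_0_iff)
  then have balance: "m * (1 - \<tau>)\<^sup>2 = l * \<tau>\<^sup>2"
    using \<open>l > 0\<close> \<open>m > 0\<close> by (simp add: power_mult_distrib)
  have "\<phi> \<tau> - \<phi> 0 \<le> (\<phi>' 0 * \<tau> + l * \<tau>\<^sup>2 / 2) - (\<phi>' 0 * 0 + l * 0\<^sup>2 / 2)"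
  proof (rule increment_le_of_derivative_le)
    fix t assume t: "0 \<le> t" "t \<le> \<tau>"
    show "(\<phi> has_real_derivative \<phi>' t) (at t)" using deriv t \<tau> by simp
    show "((\<lambda>t. \<phi>' 0 * t + l * t\<^sup>2 / 2) has_real_derivative \<phi>' 0 + l * t) (at t)"
      by (auto intro!: derivative_eq_intros)
    show "\<phi>' t \<le> \<phi>' 0 + l * t" using upper[of t] t \<tau> by simp
  qed (use \<tau> in simp)
  moreover have "\<phi> 1 - \<phi> \<tau> \<le> (m * 1\<^sup>2 / 2 - m * 1) - (m * \<tau>\<^sup>2 / 2 - m * \<tau>)"
  proof (rule increment_le_of_derivative_le)
    fix t assume t: "\<tau> \<le> t" "t \<le> 1"
    show "(\<phi> has_real_derivative \<phi>' t) (at t)" using deriv t \<tau> by simp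
    show "((\<lambda>t. m * t\<^sup>2 / 2 - m * t) has_real_derivative m * t - m) (at t)"
      by (auto intro!: derivative_eq_intros)
    show "\<phi>' t \<le> m * t - m" using lower[of t] stationary t \<tau> by (simp add: algebra_simps)
  qed (use \<tau> in simp)
  ultimately have "- \<phi>' 0 * \<tau> \<le> \<phi> 0 - \<phi> 1"
    using balance by (simp add: power2_eq_square algebra_simps)
  then show ?thesis by (simp add: \<tau>_def)
qed

lemma norm_square_spectral_norm_bound:
  fixes A :: "real^'n^'n"
  shows "\<bar>v \<bullet> (A *v v)\<bar> \<le> spectral_norm A * (norm v)\<^sup>2"
proof -
  have "norm (A *v v) \<le> spectral_norm A * norm v"
    unfolding spectral_norm_def by (intro onorm matrix_vector_mul_bounded_linear)
  then have "norm v * norm (A *v v) \<le> spectral_norm A * (norm v)\<^sup>2"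
    using mult_left_mono[of _ _ "norm v"] by (fastforce simp: power2_eq_square mult_ac)
  then show ?thesis using Cauchy_Schwarz_ineq2[of v "A *v v"] by linarith
qed

text \<open>The increment of \<open>grad \<bullet> s\<close> along the segment is the integral of \<open>s \<bullet> (hess *v s)\<close>, and the
integrand differs from \<open>s \<bullet> (H *v s)\<close> by at most \<open>\<epsilon> * (norm s)\<^sup>2\<close>.\<close>

lemma gradient_increment_near_fixed_hessian:
  fixes grad :: "real^'n \<Rightarrow> real^'n"
  assumes hess: "\<And>z. (grad has_derivative (\<lambda>h. hess z *v h)) (at z)"
    and close: "\<And>v. 0 \<le> v \<Longrightarrow> v \<le> 1 \<Longrightarrow> spectral_norm (hess (x + v *\<^sub>R s) - H) \<le> \<epsilon>"
    and tu: "0 \<le> t" "t \<le> u" "u \<le> 1"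
  shows "(grad (x + u *\<^sub>R s) - grad (x + t *\<^sub>R s)) \<bullet> s
      \<le> (s \<bullet> (H *v s) + \<epsilon> * (norm s)\<^sup>2) * (u - t)" (is ?upper)
    and "(s \<bullet> (H *v s) - \<epsilon> * (norm s)\<^sup>2) * (u - t)
      \<le> (grad (x + u *\<^sub>R s) - grad (x + t *\<^sub>R s)) \<bullet> s" (is ?lower)
proof -
  let ?\<phi> = "\<lambda>v. grad (x + v *\<^sub>R s) \<bullet> s"
  let ?\<phi>' = "\<lambda>v. s \<bullet> (hess (x + v *\<^sub>R s) *v s)"
  have deriv: "(?\<phi> has_real_derivative ?\<phi>' v) (at v)" for v
  proof -
    have "((\<lambda>v. x + v *\<^sub>R s) has_derivative (\<lambda>a. a *\<^sub>R s)) (at v)"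
      by (auto intro!: derivative_eq_intros)
    from has_derivative_inner_left[OF has_derivative_compose[OF this hess], of s]
    show ?thesis
      by (simp add: has_field_derivative_def matrix_vector_mult_scaleR inner_commute mult_commute_abs)
  qed
  have linear: "((\<lambda>v. c * v) has_real_derivative c) (at v)" for c v :: real
    by (auto intro!: derivative_eq_intros)
  have bound: "\<bar>?\<phi>' v - s \<bullet> (H *v s)\<bar> \<le> \<epsilon> * (norm s)\<^sup>2" if "t \<le> v" "v \<le> u" for v
  proof -
    have "\<bar>?\<phi>' v - s \<bullet> (H *v s)\<bar> = \<bar>s \<bullet> ((hess (x + v *\<^sub>R s) - H) *v s)\<bar>"
      by (simp add: matrix_vector_mult_diff_rdistrib inner_diff_right)
    also have "\<dots> \<le> spectral_norm (hess (x + v *\<^sub>R s) - H) * (norm s)\<^sup>2"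
      by (rule norm_square_spectral_norm_bound)
    also have "\<dots> \<le> \<epsilon> * (norm s)\<^sup>2"
      using close[of v] that tu by (intro mult_right_mono) auto
    finally show ?thesis .
  qed
  show ?upper
    using increment_le_of_derivative_le[OF \<open>t \<le> u\<close> deriv linear, of "s \<bullet> (H *v s) + \<epsilon> * (norm s)\<^sup>2"]
      bound by (fastforce simp: inner_diff_left algebra_simps abs_le_iff)
  show ?lower
    using increment_le_of_derivative_le[OF \<open>t \<le> u\<close> linear deriv, of "s \<bullet> (H *v s) - \<epsilon> * (norm s)\<^sup>2"]
      bound by (fastforce simp: inner_diff_left algebra_simps abs_le_iff)
qed

text \<open>Two instances of the one-dimensional estimate. The curvature bounds \<open>\<mu> * (norm s)\<^sup>2\<close> and
\<open>L * (norm s)\<^sup>2\<close> give the first entry of the maximum. For the second, closeness to \<open>H\<close> confines the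
curvature to an interval of length \<open>2 * \<epsilon> * (norm s)\<^sup>2\<close>. Its lower end may be useless, even negative,
and is replaced by \<open>\<mu> * (norm s)\<^sup>2\<close> if that is larger; in any case the ratio of the ends is at most
\<open>1 + 2 * \<epsilon> / \<mu>\<close>.\<close>

lemma exact_line_search_progress:
  fixes f :: "real^'n \<Rightarrow> real"
  assumes grad: "\<And>z. GDERIV f z :> grad z"
    and hess: "\<And>z. (grad has_derivative (\<lambda>h. hess z *v h)) (at z)"
    and convex: "strongly_convex \<mu> f"
    and lipschitz: "\<And>z w. norm (grad z - grad w) \<le> L * norm (z - w)"
    and close: "\<And>v. 0 \<le> v \<Longrightarrow> v \<le> 1 \<Longrightarrow> spectral_norm (hess (x + v *\<^sub>R s) - H) \<le> \<epsilon>"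
    and exact: "grad (x + s) \<bullet> s = 0" "s \<noteq> 0" and "\<mu> > 0" "\<epsilon> \<ge> 0"
  shows "- (grad x \<bullet> s) * max (1 / (1 + sqrt (L / \<mu>))) (1 / (2 * (1 + 2 * \<epsilon> / \<mu>)))
    \<le> f x - f (x + s)"
proof -
  let ?\<phi>' = "\<lambda>t. grad (x + t *\<^sub>R s) \<bullet> s"
  let ?\<sigma> = "(norm s)\<^sup>2" and ?h = "s \<bullet> (H *v s)"
  have \<sigma>: "?\<sigma> > 0" using exact by simp
  have deriv: "((\<lambda>t. f (x + t *\<^sub>R s)) has_real_derivative ?\<phi>' t) (at t)" for t
    using grad by (rule GDERIV_imp_DERIV_along_line)
  have stationary: "?\<phi>' 1 = 0" using exact by simp
  have monotone: "\<mu> * ?\<sigma> * (1 - t) \<le> ?\<phi>' 1 - ?\<phi>' t" if "0 \<le> t" "t \<le> 1" for t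
  proof (cases "t = 1")
    case False
    then have t: "1 - t > 0" using that by simp
    have diff: "(x + s) - (x + t *\<^sub>R s) = (1 - t) *\<^sub>R s" by (simp add: algebra_simps)
    have "(1 - t) * (\<mu> * ?\<sigma> * (1 - t)) \<le> (1 - t) * (?\<phi>' 1 - ?\<phi>' t)"
      using strongly_convex_gradient_monotone[OF convex grad grad, of "x + s" "x + t *\<^sub>R s"]
      unfolding diff by (simp add: inner_diff_left power2_eq_square mult_ac)
    then show ?thesis using t by simp
  qed simp
  have a: "- ?\<phi>' 0 \<ge> 0" using monotone[of 0] stationary \<sigma> \<open>\<mu> > 0\<close> by (smt (verit) mult_pos_pos)
  have "- ?\<phi>' 0 / (1 + sqrt (L * ?\<sigma> / (\<mu> * ?\<sigma>))) \<le> f (x + 0 *\<^sub>R s) - f (x + 1 *\<^sub>R s)"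
  proof (rule exact_line_search_decrease[where \<phi> = "\<lambda>t. f (x + t *\<^sub>R s)" and \<phi>' = ?\<phi>', OF deriv stationary])
    fix t :: real assume t: "0 \<le> t" "t \<le> 1"
    have "?\<phi>' t - ?\<phi>' 0 = (grad (x + t *\<^sub>R s) - grad x) \<bullet> s" by (simp add: inner_diff_left)
    also have "\<dots> \<le> norm (grad (x + t *\<^sub>R s) - grad x) * norm s" by (rule norm_cauchy_schwarz)
    also have "\<dots> \<le> (L * norm (t *\<^sub>R s)) * norm s"
      using lipschitz[of "x + t *\<^sub>R s" x] by (intro mult_right_mono) auto
    finally show "?\<phi>' t - ?\<phi>' 0 \<le> L * ?\<sigma> * t" using t by (simp add: power2_eq_square mult_ac)
  qed (use monotone \<sigma> \<open>\<mu> > 0\<close> in auto)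
  then have first: "- (grad x \<bullet> s) * (1 / (1 + sqrt (L / \<mu>))) \<le> f x - f (x + s)"
    using \<sigma> by simp
  define m where "m = max (\<mu> * ?\<sigma>) (?h - \<epsilon> * ?\<sigma>)"
  define l where "l = ?h + \<epsilon> * ?\<sigma>"
  have m: "m \<ge> \<mu> * ?\<sigma>" "m > 0" using \<sigma> \<open>\<mu> > 0\<close> by (auto simp: m_def less_max_iff_disj)
  have "- ?\<phi>' 0 / (1 + sqrt (l / m)) \<le> f (x + 0 *\<^sub>R s) - f (x + 1 *\<^sub>R s)"
  proof (rule exact_line_search_decrease[where \<phi> = "\<lambda>t. f (x + t *\<^sub>R s)" and \<phi>' = ?\<phi>', OF deriv stationary])
    fix t :: real assume t: "0 \<le> t" "t \<le> 1"
    show "?\<phi>' t - ?\<phi>' 0 \<le> l * t"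
      using gradient_increment_near_fixed_hessian(1)[OF hess close, where u = t and t = 0] t
      by (simp add: inner_diff_left l_def)
    have "(?h - \<epsilon> * ?\<sigma>) * (1 - t) \<le> ?\<phi>' 1 - ?\<phi>' t"
      using gradient_increment_near_fixed_hessian(2)[OF hess close, where u = 1 and t = t] t
      by (simp add: inner_diff_left)
    then show "m * (1 - t) \<le> ?\<phi>' 1 - ?\<phi>' t"
      using monotone[OF t] by (simp add: m_def max_def)
  qed (use m in auto)
  then have dec: "- ?\<phi>' 0 / (1 + sqrt (l / m)) \<le> f x - f (x + s)" by simp
  let ?C = "2 * \<epsilon> / \<mu>"
  have C: "?C \<ge> 0" using \<open>\<mu> > 0\<close> \<open>\<epsilon> \<ge> 0\<close> by simp
  have "l \<le> m + ?C * (\<mu> * ?\<sigma>)" using \<open>\<mu> > 0\<close> by (simp add: l_def m_def max_def)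
  also have "\<dots> \<le> m + ?C * m" using m C by (intro add_left_mono mult_left_mono) auto
  finally have "l / m \<le> 1 + ?C" using m by (simp add: field_simps)
  also have "\<dots> \<le> (1 + 2 * ?C)\<^sup>2"
  proof -
    have "1 + c \<le> (1 + 2 * c)\<^sup>2" if "c \<ge> 0" for c :: real
      using that by (simp add: power2_eq_square algebra_simps)
    then show ?thesis using C .
  qed
  finally have "sqrt (l / m) \<le> 1 + 2 * ?C" using C by (intro real_le_lsqrt) auto
  moreover have "0 < 1 + sqrt (l / m)"
  proof -
    have "l \<ge> 0"
    proof -
      have "- ?\<phi>' 0 \<le> l"
        using gradient_increment_near_fixed_hessian(1)[OF hess close, where u = 1 and t = 0] stationary
        by (simp add: inner_diff_left l_def)
      then show ?thesis using a by simp
    qed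
    then show ?thesis using m by (simp add: add_pos_nonneg)
  qed
  ultimately have "- ?\<phi>' 0 / (2 * (1 + ?C)) \<le> - ?\<phi>' 0 / (1 + sqrt (l / m))"
    using a by (intro divide_left_mono) auto
  then have "- (grad x \<bullet> s) * (1 / (2 * (1 + ?C))) \<le> f x - f (x + s)" using dec by simp
  with first show ?thesis by (simp only: max_def split: if_split) blast
qed

section \<open>One step of BFGS with exact line search\<close>

text \<open>The direction is a descent direction, so the minimizing step is positive. It is therefore an interior
minimizer on the half line, and the new gradient is orthogonal to the direction.\<close>

lemma bfgs_exact_step:
  fixes A :: "real^'n^'n"
  assumes grad: "\<And>z. GDERIV f z :> grad z"
    and A: "sym_pos_def A" and "grad x \<noteq> 0"
    and d: "d = - (matrix_inv A *v grad x)"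
    and min: "is_arg_min (\<lambda>t. f (x + t *\<^sub>R d)) (\<lambda>t. 0 \<le> t) \<eta>"
  shows "\<eta> > 0" and "A *v d = - grad x" and "grad x \<bullet> d < 0" and "grad (x + \<eta> *\<^sub>R d) \<bullet> d = 0"
proof -
  have "A ** matrix_inv A = mat 1"
    using sym_pos_def_invertible[OF A] unfolding invertible_def matrix_inv_def
    by (rule someI2_ex) blast
  then have "A *v (matrix_inv A *v grad x) = grad x" by (simp add: matrix_vector_mul_assoc)
  then show Ad: "A *v d = - grad x"
    unfolding d using matrix_vector_mult_scaleR[of A "- 1"] by simp
  then have "d \<noteq> 0" using \<open>grad x \<noteq> 0\<close> by auto
  then have "0 < d \<bullet> (A *v d)" by (rule sym_pos_def_pos[OF A])
  then show descent: "grad x \<bullet> d < 0" by (simp add: Ad inner_commute)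
  have deriv: "((\<lambda>t. f (x + t *\<^sub>R d)) has_real_derivative grad (x + t *\<^sub>R d) \<bullet> d) (at t)" for t
    using grad by (rule GDERIV_imp_DERIV_along_line)
  have \<eta>: "0 \<le> \<eta>" "\<And>t. 0 \<le> t \<Longrightarrow> f (x + \<eta> *\<^sub>R d) \<le> f (x + t *\<^sub>R d)"
    using min by (auto simp: is_arg_min_linorder)
  have "\<eta> \<noteq> 0"
  proof
    assume "\<eta> = 0"
    from DERIV_neg_dec_right[OF deriv[of 0]] descent obtain e where
      e: "0 < e" "\<And>h. 0 < h \<Longrightarrow> h < e \<Longrightarrow> f (x + h *\<^sub>R d) < f x"
      by (auto simp: algebra_simps)
    have "f (x + (e / 2) *\<^sub>R d) < f x" using e by simp
    moreover have "f x \<le> f (x + (e / 2) *\<^sub>R d)" using \<eta>(2)[of "e / 2"] e(1) \<open>\<eta> = 0\<close> by simp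
    ultimately show False by simp
  qed
  then show "\<eta> > 0" using \<eta> by simp
  then show "grad (x + \<eta> *\<^sub>R d) \<bullet> d = 0"
    using \<eta>(2) by (intro DERIV_local_min[OF deriv, of \<eta>]) auto
qed

text \<open>Since \<open>A *v s = - \<eta> *\<^sub>R g\<close>, the update multiplies the determinant by \<open>1 / \<eta>\<close> and lowers the
scaled trace by \<open>u = \<eta> (norm g)\<^sup>2 / (L (- g \<bullet> s))\<close>, while cocoercivity bounds the trace added by
\<open>y\<close> by one. The unknown step size \<open>\<eta>\<close> disappears through \<open>ln u - u \<le> - 1\<close>.\<close>

lemma bfgs_potential_step:
  assumes A: "sym_pos_def A" and "L > 0" "\<eta> > 0"
    and quasi_newton: "A *v s = - \<eta> *\<^sub>R g" and descent: "g \<bullet> s < 0" and exact: "g' \<bullet> s = 0"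
    and cocoercive: "(norm (g' - g))\<^sup>2 \<le> L * (s \<bullet> (g' - g))"
  shows "bfgs_potential L (bfgs_update A s (g' - g))
    \<le> bfgs_potential L A + ln (L * - (g \<bullet> s) / (norm g)\<^sup>2)"
proof -
  let ?y = "g' - g" and ?a = "- (g \<bullet> s)"
  have a: "?a > 0" and g: "g \<noteq> 0" using descent by auto
  have sy: "s \<bullet> ?y = ?a" using exact by (simp add: inner_diff_right inner_commute)
  have sAs: "s \<bullet> (A *v s) = \<eta> * ?a" by (simp add: quasi_newton inner_commute)
  have det: "det A > 0" using sym_pos_def_det_pos_and_potential_nonneg[OF A \<open>L > 0\<close>] by simp
  define u where "u = \<eta> * (norm g)\<^sup>2 / (L * ?a)"
  have u: "u > 0" using a g \<open>L > 0\<close> \<open>\<eta> > 0\<close> unfolding u_def by (intro divide_pos_pos mult_pos_pos) auto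
  have "bfgs_potential L (bfgs_update A s ?y)
    = bfgs_potential L A + ((norm ?y)\<^sup>2 / ?a - (norm (A *v s))\<^sup>2 / (\<eta> * ?a)) / L - ln (?a / (\<eta> * ?a))"
    using bfgs_potential_update[OF A _ det, of s ?y L] a unfolding sy sAs by simp
  also have "ln (?a / (\<eta> * ?a)) = - ln \<eta>" using a \<open>\<eta> > 0\<close> by (simp add: ln_div)
  also have "((norm ?y)\<^sup>2 / ?a - (norm (A *v s))\<^sup>2 / (\<eta> * ?a)) / L = (norm ?y)\<^sup>2 / (L * ?a) - u"
    unfolding quasi_newton u_def using a \<open>\<eta> > 0\<close> \<open>L > 0\<close>
    by (simp add: power_mult_distrib power2_eq_square field_simps)
  also have "(norm ?y)\<^sup>2 / (L * ?a) \<le> 1"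
    using cocoercive a \<open>L > 0\<close> unfolding sy by (subst pos_divide_le_eq) (auto simp: mult_pos_neg)
  also have "ln \<eta> = ln u + ln (L * ?a / (norm g)\<^sup>2)"
  proof -
    have "u * (L * ?a / (norm g)\<^sup>2) = \<eta>" using a g \<open>L > 0\<close> by (simp add: u_def)
    moreover have "L * ?a / (norm g)\<^sup>2 > 0" using a g \<open>L > 0\<close> by (intro divide_pos_pos mult_pos_pos) auto
    ultimately show ?thesis using u ln_mult_pos by metis
  qed
  finally show ?thesis using ln_le_minus_one[OF u] by simp
qed

section \<open>From the potential to convergence rates\<close>

text \<open>Two applications of the inequality between arithmetic and geometric means: the mean \<open>m\<close> of the \<open>c i\<close>
is at least their geometric mean, hence at least \<open>X\<close>, and the geometric mean of the \<open>1 - c i\<close> is at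
most \<open>1 - m\<close>.\<close>

lemma contraction_le_geometric_mean_power:
  fixes F c :: "nat \<Rightarrow> real"
  assumes F: "\<And>i. F i > 0" and c: "\<And>i. c i > 0"
    and step: "\<And>i. F (Suc i) \<le> (1 - c i) * F i"
    and "X > 0" "k \<ge> 1" and X: "real k * ln X \<le> (\<Sum>i<k. ln (c i))"
  shows "F k / F 0 \<le> (1 - X) ^ k"
proof -
  have c_nz: "c i \<noteq> 0" for i using c[of i] by simp
  have c1: "1 - c i > 0" for i
    using F[of i] F[of "Suc i"] step[of i] by (smt (verit) mult_nonpos_nonneg)
  have prod: "F n / F 0 \<le> (\<Prod>i<n. 1 - c i)" for n
  proof (induction n)
    case (Suc n)
    have "F (Suc n) / F 0 \<le> (1 - c n) * (F n / F 0)"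
      using divide_right_mono[OF step[of n], of "F 0"] F[of 0] by simp
    also have "\<dots> \<le> (1 - c n) * (\<Prod>i<n. 1 - c i)" using Suc c1[of n] by (intro mult_left_mono) auto
    finally show ?case by (simp add: mult.commute)
  qed (use F[of 0] in simp)
  define m where "m = (\<Sum>i<k. c i) / k"
  have ne: "{..<k} \<noteq> {}" using \<open>k \<ge> 1\<close> by (auto simp: lessThan_empty_iff)
  have "(\<Prod>i<k. 1 - c i) powr (1 / k) \<le> (\<Sum>i<k. (1 - c i) / k)"
    using arith_geom_mean[of "{..<k}" "\<lambda>i. 1 - c i"] c1 ne by (simp add: less_imp_le)
  also have "\<dots> = 1 - m"
    using \<open>k \<ge> 1\<close> by (simp add: m_def sum_subtractf diff_divide_distrib flip: sum_divide_distrib)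
  finally have GM: "(\<Prod>i<k. 1 - c i) powr (1 / k) \<le> 1 - m" .
  have pos: "(\<Prod>i<k. 1 - c i) > 0" using c1 by (intro prod_pos) auto
  have "(\<Prod>i<k. 1 - c i) = ((\<Prod>i<k. 1 - c i) powr (1 / k)) ^ k"
  proof -
    have "(\<Prod>i<k. 1 - c i) \<noteq> 0" using pos by linarith
    from powr_power[OF this, of "1 / k" k] show ?thesis using pos \<open>k \<ge> 1\<close> by simp
  qed
  also have "\<dots> \<le> (1 - m) ^ k" using GM by (intro power_mono) auto
  finally have prod_m: "(\<Prod>i<k. 1 - c i) \<le> (1 - m) ^ k" .
  have c_pos: "(\<Prod>i<k. c i) > 0" using c by (intro prod_pos) auto
  have "ln (\<Prod>i<k. c i) = (\<Sum>i<k. ln (c i))" using c by (intro ln_prod) (use c_nz in auto)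
  then have "ln X \<le> ln ((\<Prod>i<k. c i) powr (1 / k))"
    using X c_pos \<open>k \<ge> 1\<close> by (simp add: ln_powr field_simps)
  then have "X \<le> (\<Prod>i<k. c i) powr (1 / k)" using \<open>X > 0\<close> c_pos c_nz by (subst (asm) ln_le_cancel_iff) auto
  also have "\<dots> \<le> m"
    using arith_geom_mean[of "{..<k}" c] c ne by (simp add: less_imp_le m_def sum_divide_distrib)
  finally have "X \<le> m" .
  moreover have "0 \<le> 1 - m" using GM powr_ge_zero order_trans by blast
  ultimately have "(1 - m) ^ k \<le> (1 - X) ^ k" by (intro power_mono) auto
  then show ?thesis using prod[of k] prod_m by linarith
qed

text \<open>The summand with index \<open>0\<close> is charged to the geometric series even if \<open>0 < P\<close>. Only the indices from
\<open>1\<close> up to \<open>P\<close> are then counted separately, so that \<open>P\<close> does not have to be rounded up.\<close>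

lemma sum_eventually_geometric_le:
  fixes b :: "nat \<Rightarrow> real"
  assumes "\<And>i. b i \<le> 1" "\<And>i. P \<le> real i \<Longrightarrow> b i \<le> q ^ i" "0 \<le> P" "0 \<le> q" "q < 1"
  shows "(\<Sum>i<k. b i) \<le> P + 1 / (1 - q)"
proof -
  let ?early = "{i. 1 \<le> i \<and> real i < P}"
  have "(\<Sum>i<k. b i) \<le> (\<Sum>i<k. of_bool (i \<in> ?early) + q ^ i)"
  proof (intro sum_mono)
    fix i
    show "b i \<le> of_bool (i \<in> ?early) + q ^ i"
      using assms(1)[of i] assms(2)[of i] zero_le_power[OF assms(4), of i]
      by (cases "i = 0"; cases "real i < P") simp_all
  qed
  also have "\<dots> = (\<Sum>i<k. of_bool (i \<in> ?early)) + (\<Sum>i<k. q ^ i)" by (rule sum.distrib)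
  also have "(\<Sum>i<k. of_bool (i \<in> ?early) :: real) = card ({..<k} \<inter> ?early)"
    by (subst sum_of_bool_eq) (auto intro: arg_cong[of _ _ card])
  also have "\<dots> \<le> card {1..nat \<lfloor>P\<rfloor>}" by (intro of_nat_mono card_mono) (auto simp: le_nat_floor)
  also have "\<dots> \<le> P" using \<open>0 \<le> P\<close> by simp
  also have "(\<Sum>i<k. q ^ i) = (1 - q ^ k) / (1 - q)" using \<open>q < 1\<close> by (simp add: sum_gp_strict)
  also have "\<dots> \<le> 1 / (1 - q)" using assms(4,5) by (intro divide_right_mono) auto
  finally show ?thesis by simp
qed

text \<open>All three rates compare \<open>k * ln X\<close>, for the respective \<open>X\<close>, with the sum of the logarithms of the
relative decreases (fact \<open>core\<close>); they differ only in the estimate of the factors \<open>r i\<close>. The first two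
use \<open>r i \<ge> \<rho>\<close>. The third uses \<open>ln (r i) \<ge> - C i\<close> and sums the \<open>C i\<close>, whose decay is known from
the second rate. The constant \<open>3\<close> is an upper bound for \<open>exp 1\<close>.\<close>

lemma rates_from_potential_bound:
  fixes F w :: "nat \<Rightarrow> real"
  assumes F: "\<And>i. F i > 0" and w: "\<And>i. w i > 0" and "\<kappa> \<ge> 1" "C0 \<ge> 0" "P \<ge> 0"
    and step: "\<And>i. F (Suc i)
      \<le> (1 - max (2 / (1 + sqrt \<kappa>)) (1 / (1 + C0 * sqrt (F i / F 0))) / \<kappa> * w i) * F i"
    and potential: "\<And>k. - P \<le> (\<Sum>i<k. ln (w i))"
    and "k \<ge> 1"
  defines "\<rho> \<equiv> max (2 / (1 + sqrt \<kappa>)) (1 / (1 + C0))"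
  shows "F k / F 0 \<le> (1 - exp (- (P / k)) * (1 / \<kappa>) * \<rho>) ^ k"
    and "P \<le> k \<Longrightarrow> F k / F 0 \<le> (1 - 1 / (3 * \<kappa>) * \<rho>) ^ k"
    and "(1 + C0) * P + 3 * C0 * \<kappa> * min (2 * (1 + C0)) (1 + sqrt \<kappa>) \<le> k
      \<Longrightarrow> F k / F 0 \<le> (1 - 1 / (3 * \<kappa>)) ^ k"
proof -
  define C where "C i = C0 * sqrt (F i / F 0)" for i
  define r where "r i = max (2 / (1 + sqrt \<kappa>)) (1 / (1 + C i))" for i
  have C: "C i \<ge> 0" for i using F \<open>C0 \<ge> 0\<close> by (simp add: C_def less_imp_le)
  have rt: "sqrt \<kappa> \<ge> 1" using \<open>\<kappa> \<ge> 1\<close> by simp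
  then have "2 / (1 + sqrt \<kappa>) > 0" by (intro divide_pos_pos) linarith+
  then have \<rho>_pos: "\<rho> > 0" and r_pos: "r i > 0" for i
    by (simp_all add: \<rho>_def r_def less_max_iff_disj)
  have "F (Suc i) \<le> F i" for i
  proof -
    have "F (Suc i) \<le> (1 - r i / \<kappa> * w i) * F i" using step by (simp add: r_def C_def)
    also have "\<dots> \<le> 1 * F i" using r_pos[of i] w[of i] F[of i] \<open>\<kappa> \<ge> 1\<close> by (intro mult_right_mono) auto
    finally show ?thesis by simp
  qed
  then have "F i \<le> F 0" for i by (simp add: lift_Suc_antimono_le[of F 0 i])
  then have F_ratio: "sqrt (F i / F 0) \<le> 1" for i using F[of 0] by simp
  have "C i \<le> C0" for i unfolding C_def using mult_left_mono[OF F_ratio \<open>C0 \<ge> 0\<close>] by simp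
  then have \<rho>_le: "\<rho> \<le> r i" for i
    unfolding \<rho>_def r_def using C[of i] \<open>C0 \<ge> 0\<close> by (intro max.mono order_refl divide_left_mono) auto
  have core: "F n / F 0 \<le> (1 - X) ^ n"
    if "X > 0" "n \<ge> 1" "real n * ln X \<le> - P - n * ln \<kappa> + (\<Sum>i<n. ln (r i))" for X n
  proof (rule contraction_le_geometric_mean_power[where c = "\<lambda>i. r i / \<kappa> * w i"])
    show "F (Suc i) \<le> (1 - r i / \<kappa> * w i) * F i" for i using step by (simp add: r_def C_def)
    have "(\<Sum>i<n. ln (r i / \<kappa> * w i)) = (\<Sum>i<n. ln (r i) - ln \<kappa> + ln (w i))"
    proof (intro sum.cong refl)
      fix i
      show "ln (r i / \<kappa> * w i) = ln (r i) - ln \<kappa> + ln (w i)"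
        using r_pos[of i] w[of i] \<open>\<kappa> \<ge> 1\<close> by (simp add: ln_mult_pos ln_div)
    qed
    then show "real n * ln X \<le> (\<Sum>i<n. ln (r i / \<kappa> * w i))"
      using that(3) potential[of n] by (simp add: sum.distrib sum_subtractf)
  qed (use F w r_pos \<open>\<kappa> \<ge> 1\<close> that in auto)
  have sum_r: "real n * ln \<rho> \<le> (\<Sum>i<n. ln (r i))" for n
    using sum_mono[of "{..<n}" "\<lambda>_. ln \<rho>" "\<lambda>i. ln (r i)"] \<rho>_le \<rho>_pos r_pos by simp
  have ln3: "ln 3 \<ge> (1::real)" using exp_le by (simp add: ln_ge_iff)
  show "F k / F 0 \<le> (1 - exp (- (P / k)) * (1 / \<kappa>) * \<rho>) ^ k"
  proof (rule core)
    have "ln (exp (- (P / k)) * (1 / \<kappa>) * \<rho>) = - (P / k) - ln \<kappa> + ln \<rho>"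
      using \<rho>_pos \<open>\<kappa> \<ge> 1\<close> by (simp add: ln_mult_pos ln_div)
    then have "k * ln (exp (- (P / k)) * (1 / \<kappa>) * \<rho>) = k * (- (P / k) - ln \<kappa> + ln \<rho>)"
      by (rule arg_cong)
    also have "\<dots> = - P - k * ln \<kappa> + k * ln \<rho>"
      using \<open>k \<ge> 1\<close> by (simp add: algebra_simps)
    finally have "k * ln (exp (- (P / k)) * (1 / \<kappa>) * \<rho>) = - P - k * ln \<kappa> + k * ln \<rho>" .
    then show "k * ln (exp (- (P / k)) * (1 / \<kappa>) * \<rho>) \<le> - P - k * ln \<kappa> + (\<Sum>i<k. ln (r i))"
      using sum_r[of k] by simp
  qed (use \<rho>_pos \<open>\<kappa> \<ge> 1\<close> \<open>k \<ge> 1\<close> in auto)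
  have linear: "F n / F 0 \<le> (1 - 1 / (3 * \<kappa>) * \<rho>) ^ n" if "P \<le> n" "n \<ge> 1" for n
  proof (rule core)
    have "ln (1 / (3 * \<kappa>) * \<rho>) = - ln 3 - ln \<kappa> + ln \<rho>"
      using \<rho>_pos \<open>\<kappa> \<ge> 1\<close> by (simp add: ln_mult_pos ln_div)
    then have "n * ln (1 / (3 * \<kappa>) * \<rho>) = n * (- ln 3 - ln \<kappa> + ln \<rho>)"
      by (rule arg_cong)
    also have "\<dots> = - (n * ln 3) - n * ln \<kappa> + n * ln \<rho>"
      by (simp add: algebra_simps)
    finally have "n * ln (1 / (3 * \<kappa>) * \<rho>) = - (n * ln 3) - n * ln \<kappa> + n * ln \<rho>" .
    moreover have "real n * 1 \<le> n * ln 3" using ln3 by (intro mult_left_mono) auto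
    ultimately show "n * ln (1 / (3 * \<kappa>) * \<rho>) \<le> - P - n * ln \<kappa> + (\<Sum>i<n. ln (r i))"
      using sum_r[of n] that by linarith
  qed (use \<rho>_pos \<open>\<kappa> \<ge> 1\<close> that in auto)
  then show "P \<le> k \<Longrightarrow> F k / F 0 \<le> (1 - 1 / (3 * \<kappa>) * \<rho>) ^ k" using \<open>k \<ge> 1\<close> by blast
  show "F k / F 0 \<le> (1 - 1 / (3 * \<kappa>)) ^ k"
    if k: "(1 + C0) * P + 3 * C0 * \<kappa> * min (2 * (1 + C0)) (1 + sqrt \<kappa>) \<le> k"
  proof -
    define q where "q = 1 / (3 * \<kappa>) * \<rho>"
    have "2 \<le> 1 + sqrt \<kappa>" using add_left_mono[OF rt, of 1] by (simp only: one_add_one)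
    moreover have "2 / y \<le> 1" if "2 \<le> y" for y :: real using that by simp
    ultimately have "2 / (1 + sqrt \<kappa>) \<le> 1" by blast
    then have "\<rho> \<le> 1" using \<open>C0 \<ge> 0\<close> by (simp add: \<rho>_def)
    then have q: "0 < q" "q < 1" using \<rho>_pos \<open>\<kappa> \<ge> 1\<close> by (auto simp: q_def divide_less_eq)
    define b where "b = sqrt (1 - q)"
    have b: "0 \<le> b" "b < 1" "(1 - b) * (1 + b) = q"
      using q by (auto simp: b_def real_less_lsqrt algebra_simps)
    have "(\<Sum>i<k. sqrt (F i / F 0)) \<le> P + 1 / (1 - b)"
    proof (rule sum_eventually_geometric_le)
      fix i assume i: "P \<le> real i"
      show "sqrt (F i / F 0) \<le> b ^ i"
      proof (cases "i = 0")
        case False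
        then have "sqrt (F i / F 0) \<le> sqrt ((1 - q) ^ i)"
          using linear[OF i] by (simp add: q_def)
        then show ?thesis by (simp add: b_def real_sqrt_power)
      qed (use F[of 0] in simp)
    qed (use F_ratio b \<open>P \<ge> 0\<close> in auto)
    also have "1 / (1 - b) = (1 + b) / q" unfolding b(3)[symmetric] using b(1,2) by simp
    also have "\<dots> \<le> 2 / q" using b q by (intro divide_right_mono) auto
    also have "2 / q = 3 * \<kappa> * min (2 * (1 + C0)) (1 + sqrt \<kappa>)"
    proof -
      have "2 / max (2 / a) (1 / c) = min (2 * c) a" if "a > 0" "c > 0" for a c :: real
        using that by (auto simp: max_def min_def field_simps)
      moreover have "1 + sqrt \<kappa> > 0" "1 + C0 > 0" using \<open>\<kappa> \<ge> 1\<close> \<open>C0 \<ge> 0\<close> by (auto intro: add_pos_nonneg)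
      ultimately have "2 / \<rho> = min (2 * (1 + C0)) (1 + sqrt \<kappa>)" unfolding \<rho>_def by blast
      moreover have "2 / q = 3 * \<kappa> * (2 / \<rho>)" by (simp add: q_def)
      ultimately show ?thesis by (simp only:)
    qed
    finally have "C0 * (\<Sum>i<k. sqrt (F i / F 0)) 
        \<le> C0 * (P + 3 * \<kappa> * min (2 * (1 + C0)) (1 + sqrt \<kappa>))"
      using \<open>C0 \<ge> 0\<close> by (intro mult_left_mono) auto
    then have sum_C: "(\<Sum>i<k. C i) \<le> k - P"
      using k by (simp add: C_def sum_distrib_left algebra_simps)
    have "ln (r i) \<ge> - C i" for i
    proof -
      have "- C i \<le> ln (1 / (1 + C i))" using ln_add_one_self_le_self[OF C[of i]] C[of i] by (simp add: ln_div)
      also have "\<dots> \<le> ln (r i)" using C[of i] r_pos[of i] by (simp add: r_def)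
      finally show ?thesis .
    qed
    then have "- (\<Sum>i<k. C i) \<le> (\<Sum>i<k. ln (r i))" unfolding sum_negf[symmetric] by (rule sum_mono)
    then have sum_ln: "P - k \<le> (\<Sum>i<k. ln (r i))" using sum_C by simp
    show ?thesis
    proof (rule core)
      have "k * ln (1 / (3 * \<kappa>)) = - (k * ln 3) - k * ln \<kappa>"
        using \<open>\<kappa> \<ge> 1\<close> by (simp add: ln_div ln_mult_pos algebra_simps)
      moreover have "real k * 1 \<le> k * ln 3" using ln3 by (intro mult_left_mono) auto
      ultimately show "k * ln (1 / (3 * \<kappa>)) \<le> - P - k * ln \<kappa> + (\<Sum>i<k. ln (r i))"
        using sum_ln by simp
    qed (use \<open>\<kappa> \<ge> 1\<close> \<open>k \<ge> 1\<close> in auto)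
  qed
qed

section \<open>Convergence of BFGS with exact line search\<close>

theorem corollary1:
  fixes f :: "real^'n \<Rightarrow> real"
    and grad :: "real^'n \<Rightarrow> real^'n"
    and hess :: "real^'n \<Rightarrow> real^'n^'n"
    and xstar :: "real^'n"
    and x :: "nat \<Rightarrow> real^'n"
    and B :: "nat \<Rightarrow> real^'n^'n"
    and \<eta> :: "nat \<Rightarrow> real"
    and \<mu> L M \<alpha> \<kappa> C0 d :: real
  assumes grad: "\<And>z. GDERIV f z :> grad z"
    and hess: "\<And>z. (grad has_derivative (\<lambda>h. hess z *v h)) (at z)"
    and cont_hess: "continuous_on UNIV hess"
    and minimizer: "\<And>z. f xstar \<le> f z"
    and pos: "\<mu> > 0" "L > 0" "M > 0"
    and strongly_convex: "strongly_convex \<mu> f"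
    and lipschitz_grad: "\<And>z w. norm (grad z - grad w) \<le> L * norm (z - w)"
    and lipschitz_hess: "\<And>z. spectral_norm (hess z - hess xstar) \<le> M * norm (z - xstar)"
    and alpha: "\<alpha> > 0"
    and B0: "B 0 = \<alpha> *\<^sub>R mat 1"
    and bfgs: "bfgs_exact_line_search f grad x B \<eta>"
    and not_opt: "\<And>k. x k \<noteq> xstar"
    and d: "d = real CARD('n)"
    and kappa: "\<kappa> = L / \<mu>"
    and C0: "C0 = 2 * M / (\<mu> powr (3/2)) * sqrt (2 * (f (x 0) - f xstar))"
  shows
    "(\<forall>k::nat. k \<ge> 1 \<longrightarrow>
        (f (x k) - f xstar) / (f (x 0) - f xstar)
          \<le> (1 - exp (- ((\<alpha> / L * d - d + d * ln (L / \<alpha>)) / real k))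
                  * (1 / \<kappa>) * max (2 / (1 + sqrt \<kappa>)) (1 / (1 + C0))) ^ k)
     \<and>
     (\<forall>k::nat. k \<ge> 1 \<and> real k \<ge> d * (\<alpha> / L - 1 + ln (L / \<alpha>)) \<longrightarrow>
        (f (x k) - f xstar) / (f (x 0) - f xstar)
          \<le> (1 - 1 / (3 * \<kappa>) * max (2 / (1 + sqrt \<kappa>)) (1 / (1 + C0))) ^ k)
     \<and>
     (\<forall>k::nat. k \<ge> 1 \<and>
        real k \<ge> (1 + C0) * d * (\<alpha> / L - 1 + ln (L / \<alpha>))
                   + 3 * C0 * \<kappa> * min (2 * (1 + C0)) (1 + sqrt \<kappa>) \<longrightarrow>
        (f (x k) - f xstar) / (f (x 0) - f xstar) \<le> (1 - 1 / (3 * \<kappa>)) ^ k)"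
proof -
  define F where "F i = f (x i) - f xstar" for i
  define w where "w i = L * - (grad (x i) \<bullet> (x (Suc i) - x i)) / (norm (grad (x i)))\<^sup>2" for i
  define P where "P = d * (\<alpha> / L - 1 + ln (L / \<alpha>))"
  have grad_xstar: "grad xstar = 0" using GDERIV_at_minimizer[OF grad minimizer] .
  have growth: "\<mu> / 2 * (norm (z - xstar))\<^sup>2 \<le> f z - f xstar" for z
    using strongly_convex_gradient_lower_bound[OF strongly_convex grad, of xstar z] by (simp add: grad_xstar)
  have grad_nz: "grad (x i) \<noteq> 0" for i
  proof
    assume "grad (x i) = 0"
    then have "\<mu> / 2 * (norm (xstar - x i))\<^sup>2 \<le> 0"
      using strongly_convex_gradient_lower_bound[OF strongly_convex grad, of "x i" xstar]
        minimizer[of "x i"] by simp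
    then show False using not_opt[of i] pos by (simp add: mult_le_0_iff)
  qed
  have F_pos: "F i > 0" for i
  proof -
    have "\<mu> / 2 * (norm (x i - xstar))\<^sup>2 > 0" using not_opt[of i] pos by simp
    then show ?thesis using growth[of "x i"] by (simp add: F_def)
  qed
  have cocoercive: "(norm (grad z - grad v))\<^sup>2 \<le> L * ((z - v) \<bullet> (grad z - grad v))" for v z
  proof (rule gradient_cocoercive[where f = f])
    show "f a + grad a \<bullet> (b - a) \<le> f b" for a b
    proof -
      have "0 \<le> \<mu> / 2 * (norm (b - a))\<^sup>2" using pos by simp
      then show ?thesis using strongly_convex_gradient_lower_bound[OF strongly_convex grad, of a b] by linarith
    qed
  qed (use lipschitz_gradient_upper_bound[OF grad lipschitz_grad] pos in auto)
  define s where "s i = x (Suc i) - x i" for i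
  have step: "\<eta> i > 0 \<and> B i *v s i = - \<eta> i *\<^sub>R grad (x i)
      \<and> grad (x i) \<bullet> s i < 0 \<and> grad (x (Suc i)) \<bullet> s i = 0"
    if B: "sym_pos_def (B i)" for i
  proof -
    define D where "D = - (matrix_inv (B i) *v grad (x i))"
    have min: "is_arg_min (\<lambda>t. f (x i + t *\<^sub>R D)) (\<lambda>t. 0 \<le> t) (\<eta> i)" 
      and x_Suc: "x (Suc i) = x i + \<eta> i *\<^sub>R D"
      using bfgs unfolding bfgs_exact_line_search_def Let_def D_def by blast+
    have s: "s i = \<eta> i *\<^sub>R D" by (simp add: s_def x_Suc)
    note exact = bfgs_exact_step[OF grad B grad_nz D_def min]
    show ?thesis
      using exact unfolding x_Suc s by (simp add: matrix_vector_mult_scaleR mult_pos_neg)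
  qed
  have B_Suc: "B (Suc i) = bfgs_update (B i) (s i) (grad (x (Suc i)) - grad (x i))" for i
    using bfgs unfolding bfgs_exact_line_search_def Let_def s_def by blast
  have B_spd: "sym_pos_def (B i)" for i
  proof (induction i)
    case 0
    then show ?case using alpha by (simp add: B0 sym_pos_def_scaleR_mat_1)
  next
    case (Suc i)
    then show ?case
      using step[OF Suc] unfolding B_Suc
      by (intro sym_pos_def_bfgs_update) (auto simp: inner_diff_right inner_commute)
  qed
  note step = step[OF B_spd]
  have w_pos: "w i > 0" for i
    using step[of i] grad_nz[of i] pos unfolding w_def s_def[symmetric]
    by (intro divide_pos_pos mult_pos_pos) auto
  have potential_step: "bfgs_potential L (B (Suc i)) \<le> bfgs_potential L (B i) + ln (w i)" for i
    unfolding B_Suc w_def s_def[symmetric]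
    using step[of i] pos B_spd[of i] cocoercive[of "x (Suc i)" "x i"]
    by (intro bfgs_potential_step[where \<eta> = "\<eta> i"]) (auto simp: s_def)
  have "bfgs_potential L (B k) \<le> bfgs_potential L (B 0) + (\<Sum>i<k. ln (w i))" for k
  proof (induction k)
    case (Suc k)
    then show ?case using potential_step[of k] by simp
  qed simp
  moreover have "bfgs_potential L (B 0) = P"
    using alpha pos by (simp add: B0 bfgs_potential_scaleR_mat_1 P_def d algebra_simps)
  moreover have B_nonneg: "bfgs_potential L (B k) \<ge> 0" for k
    using sym_pos_def_det_pos_and_potential_nonneg[OF B_spd] pos by blast
  ultimately have potential: "- P \<le> (\<Sum>i<k. ln (w i))" and "P \<ge> 0" for k
    by (smt (verit))+
  have kappa_ge: "\<kappa> \<ge> 1"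
  proof -
    let ?h = "x 0 - xstar"
    have "\<mu> * (norm ?h)\<^sup>2 \<le> (grad (x 0) - grad xstar) \<bullet> ?h"
      by (rule strongly_convex_gradient_monotone[OF strongly_convex grad grad])
    also have "\<dots> \<le> norm (grad (x 0) - grad xstar) * norm ?h" by (rule norm_cauchy_schwarz)
    also have "\<dots> \<le> (L * norm ?h) * norm ?h" using lipschitz_grad by (intro mult_right_mono) auto
    finally have "\<mu> * (norm ?h)\<^sup>2 \<le> L * (norm ?h)\<^sup>2" by (simp add: power2_eq_square)
    then show ?thesis using not_opt[of 0] pos by (simp add: kappa)
  qed
  have C0_nonneg: "C0 \<ge> 0" using pos minimizer[of "x 0"] by (simp add: C0)
  \<comment> \<open>All points of the sublevel set of \<open>x i\<close> have distance at most \<open>sqrt (2 * F i / \<mu>)\<close> from the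
    minimizer, so \<open>M\<close> times this radius bounds the distance of the Hessian on step \<open>i\<close> from the one at the
    minimizer.\<close>
  have C: "2 * (M * sqrt (2 * F i / \<mu>)) / \<mu> = C0 * sqrt (F i / F 0)" for i
  proof -
    have "\<mu> powr (3 / 2) = \<mu> powr (1 + 1 / 2)" by simp
    also have "\<dots> = \<mu> * sqrt \<mu>" using pos by (simp only: powr_add powr_half_sqrt) simp
    finally have "\<mu> powr (3 / 2) = \<mu> * sqrt \<mu>" .
    then show ?thesis
      using F_pos[of 0] pos unfolding C0 F_def[symmetric] by (simp add: real_sqrt_divide real_sqrt_mult)
  qed
  have contraction: "F (Suc i)
      \<le> (1 - max (2 / (1 + sqrt \<kappa>)) (1 / (1 + C0 * sqrt (F i / F 0))) / \<kappa> * w i) * F i" for i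
  proof -
    define a where "a = - (grad (x i) \<bullet> s i)"
    define r where "r = sqrt (2 * F i / \<mu>)"
    define p where "p = max (1 / (1 + sqrt \<kappa>)) (1 / (2 * (1 + C0 * sqrt (F i / F 0))))"
    have x_Suc: "x i + s i = x (Suc i)" by (simp add: s_def)
    have a: "a > 0" using step[of i] by (simp add: a_def)
    have near: "norm (xstar - z) \<le> r" if "f z \<le> f (x i)" for z
    proof -
      have "(norm (xstar - z))\<^sup>2 \<le> 2 * F i / \<mu>"
        using growth[of z] that pos by (simp add: F_def norm_minus_commute[of xstar] field_simps)
      then show ?thesis unfolding r_def by (rule real_le_rsqrt)
    qed
    have descent: "f (x (Suc i)) \<le> f (x i)"
    proof -
      have "0 \<le> \<mu> / 2 * (norm (x i - x (Suc i)))\<^sup>2" using pos by simp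
      moreover have "grad (x (Suc i)) \<bullet> (x i - x (Suc i)) = 0"
        using step[of i] by (simp add: s_def inner_diff_right)
      ultimately show ?thesis
        using strongly_convex_gradient_lower_bound[OF strongly_convex grad, of "x (Suc i)" "x i"] by linarith
    qed
    have close: "spectral_norm (hess (x i + v *\<^sub>R s i) - hess xstar) \<le> M * r" if "0 \<le> v" "v \<le> 1" for v
    proof -
      have "x i + v *\<^sub>R s i \<in> closed_segment (x i) (x (Suc i))"
        unfolding in_segment using that by (intro exI[of _ v]) (auto simp: s_def algebra_simps)
      moreover have "closed_segment (x i) (x (Suc i)) \<subseteq> cball xstar r"
        using near descent by (intro closed_segment_subset convex_cball) (auto simp: dist_norm)
      ultimately have "norm (x i + v *\<^sub>R s i - xstar) \<le> r" by (auto simp: dist_norm norm_minus_commute)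
      then have "M * norm (x i + v *\<^sub>R s i - xstar) \<le> M * r" using pos by simp
      then show ?thesis using lipschitz_hess order_trans by blast
    qed
    have "a * max (1 / (1 + sqrt (L / \<mu>))) (1 / (2 * (1 + 2 * (M * r) / \<mu>))) \<le> f (x i) - f (x i + s i)"
      unfolding a_def using step[of i] pos F_pos[of i]
      by (intro exact_line_search_progress[OF grad hess strongly_convex lipschitz_grad close])
        (auto simp: x_Suc r_def)
    then have progress: "a * p \<le> F i - F (Suc i)"
      unfolding p_def kappa C[symmetric] r_def[symmetric] by (simp add: F_def x_Suc)
    have p: "p > 0" using kappa_ge by (simp add: p_def less_max_iff_disj add_pos_nonneg)
    have "a = w i * (norm (grad (x i)))\<^sup>2 / L"
      using pos grad_nz[of i] by (simp add: w_def a_def s_def)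
    also have "\<dots> \<ge> w i * (2 * \<mu> * F i) / L"
      using strongly_convex_gradient_dominance[OF strongly_convex grad, of "x i" xstar] pos w_pos[of i]
      by (intro divide_right_mono mult_left_mono) (auto simp: F_def)
    finally have "w i * (2 * \<mu> * F i) / L * p \<le> a * p" using p by (intro mult_right_mono) auto
    also have "w i * (2 * \<mu> * F i) / L * p = (2 * p) / \<kappa> * w i * F i"
      using pos by (simp add: kappa field_simps)
    finally have "F (Suc i) \<le> (1 - (2 * p) / \<kappa> * w i) * F i"
      using progress by (simp add: algebra_simps)
    moreover have "2 * p = max (2 / (1 + sqrt \<kappa>)) (1 / (1 + C0 * sqrt (F i / F 0)))"
    proof -
      have "2 * (1 / (2 * y)) = 1 / y" for y :: real by simp
      then show ?thesis unfolding p_def by (simp add: max_mult_distrib_left del: distrib_left_numeral)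
    qed
    ultimately show ?thesis by simp
  qed
  note rates = rates_from_potential_bound[OF F_pos w_pos kappa_ge C0_nonneg \<open>P \<ge> 0\<close> contraction potential]
  have P_alt: "\<alpha> / L * d - d + d * ln (L / \<alpha>) = P" by (simp add: P_def algebra_simps)
  have "(1 + C0) * d * (\<alpha> / L - 1 + ln (L / \<alpha>)) = (1 + C0) * P" by (simp add: P_def mult.assoc)
  then show ?thesis
    unfolding P_alt P_def[symmetric] F_def[symmetric] using rates by auto
qed

end
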